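(* Let $\ell, r$ be positive integers, let $n=\ell+r+2$, and suppose $1\le \ell\le \frac{n}{2}-2$. Then \[\operatorname{tr}(DS(\ell,r))>\operatorname{tr}(DS(\ell+1,r-1)).\]
   Context: Graphs are finite and simple. For a graph $X$, let $L=D-A$ be its Laplacian matrix, with spectral decomposition $L=\sum_\lambda \lambda E_\lambda$, where $\lambda$ runs over the distinct eigenvalues of $L$ and $E_\lambda$ is the orthogonal projection onto the $\lambda$-eigenspace. The average mixing matrix is $\widehat{M}=\sum_\lambda E_\lambda\circ E_\lambda$ ($\circ$ is the entrywise product), and the laziness of $X$ is $\operatorname{tr}(X):=\operatorname{tr}(\widehat M)=\sum_\lambda\sum_{u\in V(X)} ((E_\lambda)_{uu})^2$. The double star $DS(\ell,r)$ ($\ell,r\ge 1$) is the tree on $n=\ell+r+2$ vertices obtained from an edge $ab$ by attaching $\ell$ leaves to $a$ and $r$ leaves to $b$. *)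

theory Defs
  imports
    "Graph_Theory.Pair_Digraph"
    "Jordan_Normal_Form.Spectral_Radius"
begin

text \<open>A finite simple graph is a \<^locale>\<open>pair_graph\<close>: each edge \<open>uv\<close> is stored as the two arcs
  \<open>(u,v)\<close> and \<open>(v,u)\<close>, so the degree of a vertex is its out-degree. Rows and columns of matrices
  are indexed by vertices, hence the matrices below are meant for graphs whose vertex set is
  \<open>{0..<n}\<close>.\<close>

definition adjacency_matrix :: "nat pair_pre_digraph \<Rightarrow> real mat" where
  "adjacency_matrix G = (let n = card (pverts G) in
     mat n n (\<lambda>(i, j). if (i, j) \<in> parcs G then 1 else 0))"

definition degree_matrix :: "nat pair_pre_digraph \<Rightarrow> real mat" where
  "degree_matrix G = (let n = card (pverts G) in
     mat n n (\<lambda>(i, j). if i = j then real (out_degree (with_proj G) i) else 0))"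

definition laplacian_matrix :: "nat pair_pre_digraph \<Rightarrow> real mat" where
  "laplacian_matrix G = degree_matrix G - adjacency_matrix G"

definition eigenspace :: "real mat \<Rightarrow> real \<Rightarrow> real vec set" where
  "eigenspace A \<theta> = {v \<in> carrier_vec (dim_row A). A *\<^sub>v v = \<theta> \<cdot>\<^sub>v v}"

definition is_orthogonal_projection :: "nat \<Rightarrow> real vec set \<Rightarrow> real mat \<Rightarrow> bool" where
  "is_orthogonal_projection n W P \<longleftrightarrow> P \<in> carrier_mat n n \<and>
     (\<forall>v \<in> carrier_vec n. P *\<^sub>v v \<in> W \<and> (\<forall>w \<in> W. scalar_prod (v - P *\<^sub>v v) w = 0))"

definition eigenprojection :: "real mat \<Rightarrow> real \<Rightarrow> real mat" where
  "eigenprojection A \<theta> = (THE P. is_orthogonal_projection (dim_row A) (eigenspace A \<theta>) P)"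

definition entrywise_prod :: "real mat \<Rightarrow> real mat \<Rightarrow> real mat" where
  "entrywise_prod A B = mat (dim_row A) (dim_col A) (\<lambda>(i, j). A $$ (i, j) * B $$ (i, j))"

text \<open>The matrix sum over the distinct Laplacian eigenvalues is written entrywise, since matrices
  of unspecified dimension do not form a monoid type. A real symmetric matrix has only real
  eigenvalues, so the real \<^const>\<open>spectrum\<close> contains all of them.\<close>

definition average_mixing_matrix :: "nat pair_pre_digraph \<Rightarrow> real mat" where
  "average_mixing_matrix G = (let n = card (pverts G); L = laplacian_matrix G in
     mat n n (\<lambda>(i, j). \<Sum>\<theta>\<in>spectrum L.
       entrywise_prod (eigenprojection L \<theta>) (eigenprojection L \<theta>) $$ (i, j)))"

definition mat_trace :: "real mat \<Rightarrow> real" where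
  "mat_trace A = (\<Sum>i<dim_row A. A $$ (i, i))"

definition laziness :: "nat pair_pre_digraph \<Rightarrow> real" where
  "laziness G = mat_trace (average_mixing_matrix G)"

text \<open>The centres \<open>a\<close>, \<open>b\<close> are \<open>0\<close>, \<open>1\<close>; the leaves at \<open>a\<close> are \<open>2, \<dots>, l + 1\<close> and the leaves
  at \<open>b\<close> are \<open>l + 2, \<dots>, l + r + 1\<close>.\<close>

definition double_star :: "nat \<Rightarrow> nat \<Rightarrow> nat pair_pre_digraph" where
  "double_star l r =
     (let E = {(0, 1)} \<union> {0} \<times> {2..<l + 2} \<union> {1} \<times> {l + 2..<l + r + 2}
      in \<lparr>pverts = {0..<l + r + 2}, parcs = E \<union> E\<inverse>\<rparr>)"

lemma pair_graph_double_star: "pair_graph (double_star l r)"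
proof
  have "finite (pverts (double_star l r) \<times> pverts (double_star l r))"
    by (simp add: double_star_def Let_def)
  moreover have "parcs (double_star l r) \<subseteq> pverts (double_star l r) \<times> pverts (double_star l r)"
    by (auto simp: double_star_def Let_def)
  ultimately show "finite (parcs (double_star l r))"
    by (rule finite_subset[rotated])
qed (auto simp: double_star_def Let_def symmetric_def sym_def)

text \<open>The definite description in \<^const>\<open>eigenprojection\<close> is unambiguous.\<close>

lemma is_orthogonal_projection_unique:
  assumes P: "is_orthogonal_projection n (eigenspace A \<theta>) P"
    and Q: "is_orthogonal_projection n (eigenspace A \<theta>) Q"
    and A: "A \<in> carrier_mat n n"
  shows "P = Q"
proof -
  have PC: "P \<in> carrier_mat n n" and QC: "Q \<in> carrier_mat n n"
    using P Q by (auto simp: is_orthogonal_projection_def)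
  have eq: "P *\<^sub>v v = Q *\<^sub>v v" if v: "v \<in> carrier_vec n" for v
  proof -
    define p q where "p = P *\<^sub>v v" and "q = Q *\<^sub>v v"
    have p: "p \<in> carrier_vec n" and q: "q \<in> carrier_vec n"
      using PC QC v by (auto simp: p_def q_def)
    have pE: "p \<in> eigenspace A \<theta>" and qE: "q \<in> eigenspace A \<theta>"
      using P Q v by (auto simp: is_orthogonal_projection_def p_def q_def)
    have "A *\<^sub>v (p - q) = \<theta> \<cdot>\<^sub>v p - \<theta> \<cdot>\<^sub>v q"
      using pE qE mult_minus_distrib_mat_vec[OF A p q] by (simp add: eigenspace_def)
    also have "\<dots> = \<theta> \<cdot>\<^sub>v (p - q)"
      using p q by (intro eq_vecI) (auto simp: algebra_simps)
    finally have d: "p - q \<in> eigenspace A \<theta>"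
      using A p q by (simp add: eigenspace_def)
    have "scalar_prod (v - p) (p - q) = 0" "scalar_prod (v - q) (p - q) = 0"
      using P Q v d by (auto simp: is_orthogonal_projection_def p_def q_def)
    moreover have "(v - q) - (v - p) = p - q"
      using p q v by (intro eq_vecI) auto
    ultimately have "scalar_prod (p - q) (p - q) = 0"
      using p q v minus_scalar_prod_distrib[of "v - q" n "v - p" "p - q"] by simp
    then have "p - q = 0\<^sub>v n"
      using p q conjugate_square_eq_0_vec[of "p - q" n] by simp
    then have "(p - q) $ i = 0" if "i < n" for i
      using that by simp
    then have "p = q"
      using p q by (intro eq_vecI) auto
    then show ?thesis by (simp add: p_def q_def)
  qed
  show ?thesis
  proof (intro eq_matI)
    fix i j assume "i < dim_row Q" "j < dim_col Q"
    then have ij: "i < n" "j < n" using QC by auto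
    show "P $$ (i, j) = Q $$ (i, j)"
      using arg_cong[OF eq[of "unit_vec n j"], of "\<lambda>x. x $ i"] ij PC QC by auto
  qed (use PC QC in auto)
qed

end

(* Put n = l + r + 2 and p = l r. The Laplacian spectrum of DS(l,r) consists of the eigenvalue 1, whose
   eigenspace is the set of vectors supported on the leaves and summing to zero over each leaf class,
   the eigenvalue 0, and the three roots of the cubic f(x) = (x-1)^2 (x-n) + p x, all simple. The
   simple eigenvalue x contributes G(x) / (x f'(x))^2 for a polynomial G depending only on n. Reducing
   G(x) / x^2 modulo f and using 1 / f'(x)^2 = (y-z)^2 / disc f, the sum over the roots x, y, z is a
   symmetric function, so the laziness is an explicit rational function of n and p. Passing from
   (l,r) to (l+1,r-1) keeps n and raises p by k = r - l - 1; the cross-multiplied difference of the two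
   rational functions, written in terms of l and k, is a polynomial with positive coefficients. *)
theory Submission
  imports Defs
begin

section \<open>Eigenprojections and the Laplacian\<close>

lemma eigenprojection_eqI:
  assumes "A \<in> carrier_mat n n" and "is_orthogonal_projection n (eigenspace A \<theta>) P"
  shows "eigenprojection A \<theta> = P"
proof -
  have "dim_row A = n" using assms(1) by auto
  then show ?thesis
    unfolding eigenprojection_def
    using assms is_orthogonal_projection_unique by (intro the_equality) auto
qed

lemma laplacian_matrix_carrier:
  assumes "pverts G = {0..<n}"
  shows "laplacian_matrix G \<in> carrier_mat n n"
  using assms
  by (auto simp: laplacian_matrix_def degree_matrix_def adjacency_matrix_def Let_def
      intro: minus_carrier_mat)

text \<open>By uniqueness, any explicit family \<open>P\<close> verified on the spectrum may replace
  the definite description of the eigenprojections.\<close>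

lemma laziness_eq:
  assumes G: "pverts G = {0..<n}"
    and P: "\<And>\<theta>. \<theta> \<in> spectrum (laplacian_matrix G) \<Longrightarrow>
      is_orthogonal_projection n (eigenspace (laplacian_matrix G) \<theta>) (P \<theta>)"
  shows "laziness G = (\<Sum>\<theta>\<in>spectrum (laplacian_matrix G). \<Sum>i<n. (P \<theta> $$ (i, i))\<^sup>2)"
proof -
  have "eigenprojection (laplacian_matrix G) \<theta> = P \<theta>" "dim_row (P \<theta>) = n" "dim_col (P \<theta>) = n"
    if "\<theta> \<in> spectrum (laplacian_matrix G)" for \<theta>
    using eigenprojection_eqI[OF laplacian_matrix_carrier[OF G]] P[OF that]
    by (auto simp: is_orthogonal_projection_def)
  then have "laziness G = (\<Sum>i<n. \<Sum>\<theta>\<in>spectrum (laplacian_matrix G). (P \<theta> $$ (i, i))\<^sup>2)"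
    using G
    by (auto simp: laziness_def mat_trace_def average_mixing_matrix_def Let_def
        entrywise_prod_def power2_eq_square intro!: sum.cong)
  then show ?thesis
    by (subst sum.swap) simp
qed

lemma laplacian_mult_vec:
  assumes "pair_graph G" and G: "pverts G = {0..<n}" and v: "v \<in> carrier_vec n" and i: "i < n"
  shows "(laplacian_matrix G *\<^sub>v v) $ i = (\<Sum>j | (i, j) \<in> parcs G. v $ i - v $ j)"
proof -
  interpret pair_graph G by fact
  let ?N = "{j. (i, j) \<in> parcs G}"
  have sub: "?N \<subseteq> {0..<n}" using in_arcsD2 G by auto
  have "out_arcs (with_proj G) i = Pair i ` ?N"
    by (auto simp: out_arcs_def)
  then have deg: "real (out_degree (with_proj G) i) = real (card ?N)"
    by (simp add: out_degree_def card_image inj_on_def)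
  have L: "laplacian_matrix G \<in> carrier_mat n n"
    by (rule laplacian_matrix_carrier[OF G])
  have entry: "laplacian_matrix G $$ (i, j) =
      (if i = j then real (card ?N) else 0) - (if j \<in> ?N then 1 else 0)" if "j < n" for j
    using i that G deg
    by (auto simp: laplacian_matrix_def degree_matrix_def adjacency_matrix_def Let_def)
  have "(laplacian_matrix G *\<^sub>v v) $ i = (\<Sum>j\<in>{0..<n}. laplacian_matrix G $$ (i, j) * v $ j)"
    using i v L by (simp add: scalar_prod_def)
  also have "\<dots> = (\<Sum>j\<in>{0..<n}.
      ((if i = j then real (card ?N) else 0) - (if j \<in> ?N then 1 else 0)) * v $ j)"
    using entry by (intro sum.cong) auto
  also have "\<dots> = (\<Sum>j\<in>{0..<n}. (if j = i then real (card ?N) * v $ j else 0)) -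
      (\<Sum>j\<in>{0..<n}. (if j \<in> ?N then v $ j else 0))"
    unfolding sum_subtractf[symmetric] by (intro sum.cong) (auto simp: algebra_simps)
  also have "\<dots> = real (card ?N) * v $ i - (\<Sum>j\<in>?N. v $ j)"
    using i sub by (simp add: sum.If_cases Int_absorb1)
  also have "\<dots> = (\<Sum>j\<in>?N. v $ i - v $ j)"
    by (simp add: sum_subtractf)
  finally show ?thesis .
qed

text \<open>The rank-one projection \<open>v v^T / (v . v)\<close>; the division makes it
  independent of the scaling of \<open>v\<close>, so eigenvectors can be used unnormalized.\<close>

definition line_projection :: "nat \<Rightarrow> real vec \<Rightarrow> real mat" where
  "line_projection n v = mat n n (\<lambda>(i, j). v $ i * v $ j / (v \<bullet> v))"

lemma is_orthogonal_projection_line: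
  assumes v: "v \<in> carrier_vec n" "v \<noteq> 0\<^sub>v n" and W: "W = range (\<lambda>c. c \<cdot>\<^sub>v v)"
  shows "is_orthogonal_projection n W (line_projection n v)"
proof -
  let ?P = "line_projection n v"
  have vv: "v \<bullet> v \<noteq> 0"
    using v conjugate_square_eq_0_vec[of v n] by simp
  have P: "?P *\<^sub>v x = (v \<bullet> x / (v \<bullet> v)) \<cdot>\<^sub>v v" if "x \<in> carrier_vec n" for x
    using v that
    by (intro eq_vecI)
      (auto simp: line_projection_def scalar_prod_def sum_distrib_left sum_distrib_right sum_divide_distrib
        intro!: sum.cong)
  have "(x - ?P *\<^sub>v x) \<bullet> w = 0" if x: "x \<in> carrier_vec n" and "w \<in> W" for x w
  proof -
    obtain c where "w = c \<cdot>\<^sub>v v" using \<open>w \<in> W\<close> W by auto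
    then show ?thesis
      using x v vv comm_scalar_prod[OF x v(1)]
      by (simp add: P minus_scalar_prod_distrib[of _ n])
  qed
  then show ?thesis
    using P W by (auto simp: is_orthogonal_projection_def line_projection_def)
qed

lemma mem_spectrum_iff:
  fixes A :: "real mat"
  assumes "A \<in> carrier_mat n n"
  shows "\<theta> \<in> spectrum A \<longleftrightarrow> (\<exists>v\<in>eigenspace A \<theta>. v \<noteq> 0\<^sub>v n)"
  using assms by (auto simp: spectrum_def eigenvalue_def eigenvector_def eigenspace_def)

section \<open>The cubic factor of the characteristic polynomial\<close>

text \<open>\<open>x * cub n p x\<close> is the characteristic polynomial of the Laplacian restricted to the vectors
  that are constant on each of the two leaf classes, for \<open>n = l + r + 2\<close> and \<open>p = l * r\<close>; its
  discriminant (that of \<open>cub n p\<close>) is \<open>p * disc_factor n p\<close>.\<close>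

definition cub :: "real \<Rightarrow> real \<Rightarrow> real \<Rightarrow> real" where
  "cub n p x = (x - 1)\<^sup>2 * (x - n) + p * x"

definition disc_factor :: "real \<Rightarrow> real \<Rightarrow> real" where
  "disc_factor n p = 4 * (n - 1) ^ 3 + (n\<^sup>2 - 20 * n - 8) * p - 4 * p\<^sup>2"

text \<open>Numerator of the laziness over the denominator \<open>n * (p * disc_factor n p)\<close>,
  once \<open>n - 6 + 1 / n\<close> has been split off.\<close>

definition numer :: "real \<Rightarrow> real \<Rightarrow> real" where
  "numer n p = 6 * n * (n - 2) * (n - 1) ^ 3 + (8 * n ^ 4 - 72 * n ^ 3 + 124 * n\<^sup>2 - 36 * n + 12) * p
     + (2 * n ^ 3 - 43 * n\<^sup>2 + 88 * n + 24) * p\<^sup>2 + (12 - 8 * n) * p ^ 3"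

text \<open>A root \<open>x\<close> of the cubic contributes \<open>weight n x / (x * \<phi>' x)\<^sup>2\<close> to the laziness, where
  \<open>\<phi> = cub n p\<close>. Modulo the cubic, \<open>weight n x / x\<^sup>2\<close> is the quadratic in
  \<open>weight_mod_cub\<close>, divided by \<open>n\<^sup>2\<close>.\<close>

definition weight :: "real \<Rightarrow> real \<Rightarrow> real" where
  "weight n x = (x - 1)\<^sup>2 * (2 * (x - 1)\<^sup>2 - (n - 2) * x)\<^sup>2 - 2 * (x - 1) ^ 4
     + (n - 2) * (x - 1)\<^sup>2 - 4 * (x - 1)\<^sup>2 * (n - x) + (n - 2) * x * (n - x)"

text \<open>Polynomial division by the cubic. Its constant term is \<open>- n\<close>, so inverting
  \<open>x\<close> modulo it costs a factor \<open>n\<close>, and dividing by \<open>x^2\<close>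
  costs \<open>n^2\<close>.\<close>

lemma weight_mod_cub:
  "n\<^sup>2 * weight n x =
     x\<^sup>2 * ((3 * n ^ 4 + n ^ 3 * p - 8 * n ^ 3 - 3 * n * p\<^sup>2 - 12 * n\<^sup>2 * p + 6 * n\<^sup>2 - 6 * n * p - 3 * n)
        + (- 3 * n ^ 4 + 11 * n\<^sup>2 * p + 8 * n ^ 3 + 6 * n * p - 8 * n\<^sup>2 + 6 * n) * x
        + (n ^ 4 - 4 * n\<^sup>2 * p - 3 * n ^ 3 - 3 * n * p + 4 * n\<^sup>2 - 3 * n) * x\<^sup>2)
     + cub n p x * (4 * n\<^sup>2 * x ^ 3 - 8 * n\<^sup>2 * x\<^sup>2 - n ^ 3 * x + 3 * n * p * x + 6 * n\<^sup>2 * x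
        + 3 * n * x + 3 * n\<^sup>2)"
  unfolding weight_def cub_def by (simp add: algebra_simps power_numeral_reduce)

text \<open>The signs -, +, -, + at \<open>0\<close>, \<open>1\<close>, \<open>m\<close>,
  \<open>n\<close> give three distinct real roots by the intermediate value theorem, all different
  from the eigenvalues 0 and 1.\<close>

lemma cub_factorization:
  fixes l r :: real
  assumes "l > 0" "r > 0" and n: "n = l + r + 2" and p: "p = l * r"
  obtains x y z where "0 < x" "x < 1" "1 < y" "y < z"
    and "x + y + z = n + 2" "x * y + x * z + y * z = 2 * n + 1 + p" "x * y * z = n"
proof -
  \<comment> \<open>The cubic takes the value \<open>- l\<close> at the larger root \<open>m\<close> of \<open>(t - 1)\<^sup>2 = l * t\<close>, which separates
    its two larger roots.\<close>
  define d where "d = sqrt ((l + 2)\<^sup>2 - 4)"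
  define m where "m = (l + 2 + d) / 2"
  have disc: "0 < (l + 2)\<^sup>2 - 4" "(l + 2)\<^sup>2 - 4 < (l + 2)\<^sup>2"
    using \<open>l > 0\<close> by (simp_all add: power2_eq_square algebra_simps add_pos_pos)
  then have d: "0 < d" "d\<^sup>2 = (l + 2)\<^sup>2 - 4"
    by (auto simp: d_def)
  have "d < l + 2"
    unfolding d_def using disc \<open>l > 0\<close> by (intro real_less_lsqrt) auto
  then have m: "1 < m" "m < n"
    using d(1) assms by (auto simp: m_def)
  have m2: "m * m = (l + 2) * m - 1"
    using d(2) by (simp add: m_def power2_eq_square field_simps)
  then have "(m - 1)\<^sup>2 = l * m"
    by (simp add: power2_eq_square algebra_simps)
  then have "cub n p m = l * (m * m - (l + 2) * m)"
    by (simp add: cub_def n p algebra_simps)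
  then have cub_m: "cub n p m < 0"
    using m2 \<open>l > 0\<close> by simp
  have cub_ends: "cub n p 0 < 0" "cub n p 1 > 0" "cub n p n > 0"
    using assms by (auto simp: cub_def intro!: mult_pos_pos add_pos_pos)
  have cont: "continuous_on S (cub n p)" for S
    unfolding cub_def by (intro continuous_intros)
  obtain x where x: "0 \<le> x" "x \<le> 1" "cub n p x = 0"
    using IVT'[of "cub n p" 0 0 1] cub_ends cont by auto
  obtain y where y: "1 \<le> y" "y \<le> m" "cub n p y = 0"
    using IVT2'[of "cub n p" m 0 1] cub_ends cub_m cont m by auto
  obtain z where z: "m \<le> z" "z \<le> n" "cub n p z = 0"
    using IVT'[of "cub n p" m 0 n] cub_ends cub_m cont m by auto
  have order: "0 < x" "x < 1" "1 < y" "y < z"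
    using x y z cub_ends cub_m by (auto simp: order.order_iff_strict)
  \<comment> \<open>Divided differences: equal values at two distinct roots leave a quadratic
    relation, and the difference of two such relations yields the first of Vieta's formulas.\<close>
  have "(x - y) * (x\<^sup>2 + x * y + y\<^sup>2 - (n + 2) * (x + y) + 2 * n + 1 + p) = cub n p x - cub n p y"
    by (simp add: cub_def power2_eq_square algebra_simps)
  then have xy: "x\<^sup>2 + x * y + y\<^sup>2 - (n + 2) * (x + y) + 2 * n + 1 + p = 0"
    using x y order by simp
  have "(x - z) * (x\<^sup>2 + x * z + z\<^sup>2 - (n + 2) * (x + z) + 2 * n + 1 + p) = cub n p x - cub n p z"
    by (simp add: cub_def power2_eq_square algebra_simps)
  then have xz: "x\<^sup>2 + x * z + z\<^sup>2 - (n + 2) * (x + z) + 2 * n + 1 + p = 0"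
    using x z order by simp
  have "(y - z) * (x + y + z - (n + 2)) = 0"
    using xy xz by (simp add: power2_eq_square algebra_simps)
  then have e1: "x + y + z = n + 2"
    using order by simp
  then have z_eq: "z = n + 2 - x - y" by simp
  have e2: "x * y + x * z + y * z = 2 * n + 1 + p"
    using xy by (simp add: z_eq power2_eq_square algebra_simps)
  have "cub n p x = x ^ 3 - (x + y + z) * x\<^sup>2 + (x * y + x * z + y * z) * x - n"
    unfolding e1 e2 by (simp add: cub_def power2_eq_square power3_eq_cube algebra_simps)
  then have e3: "x * y * z = n"
    using x by (simp add: power2_eq_square power3_eq_cube algebra_simps)
  show thesis
    using that order e1 e2 e3 by blast
qed

section \<open>Symmetric functions of the three roots\<close>

lemma cub_eq_prod:
  assumes "x + y + z = n + 2" "x * y + x * z + y * z = 2 * n + 1 + p" "x * y * z = n"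
  shows "cub n p t = (t - x) * (t - y) * (t - z)"
proof -
  have "(t - x) * (t - y) * (t - z)
      = t ^ 3 - (x + y + z) * t\<^sup>2 + (x * y + x * z + y * z) * t - x * y * z"
    by (simp add: power2_eq_square power3_eq_cube algebra_simps)
  then show ?thesis
    unfolding assms by (simp add: cub_def power2_eq_square power3_eq_cube algebra_simps)
qed

text \<open>Both left sides are symmetric in the roots, so they pass through the elementary
  symmetric functions, where \<open>n\<close> and \<open>p\<close> are substituted. The subtracted
  multiple of \<open>disc_factor n p\<close> later cancels the term \<open>(n - 2) / p\<close>
  coming from the eigenvalue 1.\<close>

lemma sum_weight:
  assumes "n > 0" and nz: "x \<noteq> 0" "y \<noteq> 0" "z \<noteq> 0" and dist: "x \<noteq> y" "x \<noteq> z" "y \<noteq> z"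
    and e1: "x + y + z = n + 2" and e2: "x * y + x * z + y * z = 2 * n + 1 + p" and e3: "x * y * z = n"
  shows "((x - y) * (x - z) * (y - z))\<^sup>2 = p * disc_factor n p"
    and "weight n x / (x * ((x - y) * (x - z)))\<^sup>2 + weight n y / (y * ((y - x) * (y - z)))\<^sup>2
      + weight n z / (z * ((z - x) * (z - y)))\<^sup>2
      = (numer n p - n * (n - 2) * disc_factor n p) / (n * (p * disc_factor n p))"
proof -
  define h0 where "h0 = 3 * n ^ 4 + n ^ 3 * p - 8 * n ^ 3 - 3 * n * p\<^sup>2 - 12 * n\<^sup>2 * p + 6 * n\<^sup>2
    - 6 * n * p - 3 * n"
  define h1 where "h1 = - 3 * n ^ 4 + 11 * n\<^sup>2 * p + 8 * n ^ 3 + 6 * n * p - 8 * n\<^sup>2 + 6 * n"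
  define h2 where "h2 = n ^ 4 - 4 * n\<^sup>2 * p - 3 * n ^ 3 - 3 * n * p + 4 * n\<^sup>2 - 3 * n"
  define h where "h t = h0 + h1 * t + h2 * t\<^sup>2" for t
  define \<Delta> where "\<Delta> = ((x - y) * (x - z) * (y - z))\<^sup>2"
  have \<Delta>: "\<Delta> \<noteq> 0" using dist by (simp add: \<Delta>_def)
  \<comment> \<open>The classical discriminant of a cubic in terms of its elementary symmetric
    functions.\<close>
  have "\<Delta> = (x + y + z)\<^sup>2 * (x * y + x * z + y * z)\<^sup>2 - 4 * (x * y + x * z + y * z) ^ 3
      - 4 * (x + y + z) ^ 3 * (x * y * z)
      + 18 * (x + y + z) * (x * y + x * z + y * z) * (x * y * z) - 27 * (x * y * z)\<^sup>2"
    unfolding \<Delta>_def by (simp add: algebra_simps power_numeral_reduce)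
  also have "\<dots> = p * disc_factor n p"
    unfolding e1 e2 e3 disc_factor_def by (simp add: algebra_simps power_numeral_reduce)
  finally show disc: "((x - y) * (x - z) * (y - z))\<^sup>2 = p * disc_factor n p"
    unfolding \<Delta>_def .
  \<comment> \<open>In the uses below, \<open>d\<close> is the derivative of the cubic at the root
    \<open>t\<close> and \<open>e\<close> the difference of the other two roots. Their product is
    the Vandermonde product up to sign, with a minus only at \<open>y\<close>.\<close>
  have *: "weight n t / (t * d)\<^sup>2 = h t * e\<^sup>2 / (n\<^sup>2 * \<Delta>)"
    if "t \<noteq> 0" "d * e = (x - y) * (x - z) * (y - z) \<or> d * e = - ((x - y) * (x - z) * (y - z))"
      "t = x \<or> t = y \<or> t = z" for t d e
  proof -
    have "cub n p t = 0" using that cub_eq_prod[OF e1 e2 e3] by auto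
    then have "n\<^sup>2 * weight n t = t\<^sup>2 * h t"
      using weight_mod_cub[of n t p] by (simp add: h_def h0_def h1_def h2_def)
    moreover have "d\<^sup>2 * e\<^sup>2 = \<Delta>"
      using that(2) unfolding \<Delta>_def power_mult_distrib[symmetric] by auto
    moreover have "d \<noteq> 0" "e \<noteq> 0" using calculation(2) \<Delta> by auto
    ultimately show ?thesis
      using \<open>n > 0\<close> \<open>t \<noteq> 0\<close> \<Delta> by (auto simp: frac_eq_eq power_mult_distrib mult.commute)
  qed
  have "weight n x / (x * ((x - y) * (x - z)))\<^sup>2 + weight n y / (y * ((y - x) * (y - z)))\<^sup>2
      + weight n z / (z * ((z - x) * (z - y)))\<^sup>2
      = (h x * (y - z)\<^sup>2 + h y * (x - z)\<^sup>2 + h z * (x - y)\<^sup>2) / (n\<^sup>2 * \<Delta>)"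
    using *[of x "(x - y) * (x - z)" "y - z"] *[of y "(y - x) * (y - z)" "x - z"]
      *[of z "(z - x) * (z - y)" "x - y"] nz
    by (simp add: add_divide_distrib algebra_simps)
  also have "h x * (y - z)\<^sup>2 + h y * (x - z)\<^sup>2 + h z * (x - y)\<^sup>2
      = h0 * (2 * (x + y + z)\<^sup>2 - 6 * (x * y + x * z + y * z))
      + h1 * ((x + y + z) * (x * y + x * z + y * z) - 9 * (x * y * z))
      + h2 * (2 * (x * y + x * z + y * z)\<^sup>2 - 6 * (x + y + z) * (x * y * z))"
    unfolding h_def by (simp add: algebra_simps power_numeral_reduce)
  also have "\<dots> = n * (numer n p - n * (n - 2) * disc_factor n p)"
    unfolding e1 e2 e3 h0_def h1_def h2_def disc_factor_def numer_def by (simp add: algebra_simps power_numeral_reduce)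
  finally show "weight n x / (x * ((x - y) * (x - z)))\<^sup>2 + weight n y / (y * ((y - x) * (y - z)))\<^sup>2
      + weight n z / (z * ((z - x) * (z - y)))\<^sup>2
      = (numer n p - n * (n - 2) * disc_factor n p) / (n * (p * disc_factor n p))"
    using \<open>n > 0\<close> disc by (simp add: \<Delta>_def power2_eq_square)
qed

text \<open>The left side is the sum of squared diagonal entries of the projection onto an
  eigenvector with entries \<open>1 - x\<close>, \<open>b\<close>, \<open>l\<close> ones and
  \<open>r\<close> copies of \<open>y\<close>. On the right, \<open>l\<close> and \<open>r\<close>
  enter only through \<open>n\<close> and \<open>p\<close>, and the factor beside \<open>x\<close>
  is the derivative of the cubic.\<close>

lemma weight_eq:
  fixes l r x :: real
  assumes n: "n = l + r + 2" and p: "p = l * r" and x: "cub n p x = 0" "x \<noteq> 1"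
    and b: "b = (1 - x)\<^sup>2 - l * x" and y: "y = b / (1 - x)"
  shows "((1 - x) ^ 4 + b ^ 4 + l + r * y ^ 4) / ((1 - x)\<^sup>2 + b\<^sup>2 + l + r * y\<^sup>2)\<^sup>2
    = weight n x / (x * (3 * x\<^sup>2 - 2 * (n + 2) * x + 2 * n + 1 + p))\<^sup>2"
proof -
  \<comment> \<open>\<open>a * b = s\<close> is the eigenvalue equation; multiplying the norm by \<open>a\<close> makes it polynomial.\<close>
  define s where "s = (x - 1)\<^sup>2"
  define a where "a = s - r * x"
  have s: "s \<noteq> 0" "(1 - x)\<^sup>2 = s" "(1 - x) ^ 4 = s\<^sup>2"
    using x by (simp_all add: s_def) (simp_all add: power2_eq_square power4_eq_xxxx algebra_simps)
  have b': "b = s - l * x" using b s by simp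
  have y': "y\<^sup>2 * s = b\<^sup>2"
    using x unfolding y s(2)[symmetric] by (auto simp: power_divide)
  have "a * b - s = x * cub n p x"
    unfolding a_def b' cub_def n p s_def by (simp add: power2_eq_square algebra_simps)
  then have ab: "a * b = s" using x by simp
  then have "a \<noteq> 0" using s by auto
  \<comment> \<open>This eliminates \<open>y\<close>, which enters only through even powers.\<close>
  have y2: "a * y\<^sup>2 = b"
  proof -
    have "s * (a * y\<^sup>2) = a * (y\<^sup>2 * s)" by simp
    also have "\<dots> = s * b" unfolding y' by (simp add: power2_eq_square flip: ab)
    finally have "s * (a * y\<^sup>2) = s * b" .
    then show ?thesis using s by simp
  qed
  have "a * (s + b\<^sup>2 + l + r * y\<^sup>2) = s * a + (a * b) * b + l * a + r * (a * y\<^sup>2)"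
    by (simp add: power2_eq_square algebra_simps)
  \<comment> \<open>Exchanging \<open>l\<close> and \<open>r\<close> exchanges \<open>a\<close> and
    \<open>b\<close>, so this expression is a polynomial in \<open>n\<close>, \<open>p\<close> and
    \<open>x\<close>.\<close>
  also have "\<dots> = s * (a + b) + l * a + r * b"
    unfolding ab y2 by (simp add: algebra_simps)
  also have "\<dots> = (x - 1) * (x * (3 * x\<^sup>2 - 2 * (n + 2) * x + 2 * n + 1 + p)) - (x + 1) * cub n p x"
    unfolding a_def b' cub_def n p s_def by (simp add: power2_eq_square algebra_simps)
  finally have den: "a * (s + b\<^sup>2 + l + r * y\<^sup>2)
      = (x - 1) * (x * (3 * x\<^sup>2 - 2 * (n + 2) * x + 2 * n + 1 + p))"
    using x by simp
  have "a\<^sup>2 * (s\<^sup>2 + b ^ 4 + l + r * y ^ 4)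
      = s\<^sup>2 * a\<^sup>2 + (a * b)\<^sup>2 * b\<^sup>2 + l * a\<^sup>2 + r * (a * y\<^sup>2)\<^sup>2"
    by (simp add: power2_eq_square power4_eq_xxxx algebra_simps)
  also have "\<dots> = s\<^sup>2 * (a\<^sup>2 + b\<^sup>2) + (l * a\<^sup>2 + r * b\<^sup>2)"
    unfolding ab y2 by (simp add: algebra_simps)
  also have "a\<^sup>2 + b\<^sup>2 = (a + b)\<^sup>2 - 2 * s"
    by (simp add: power2_eq_square algebra_simps flip: ab)
  \<comment> \<open>At a root, \<open>p * x = - (x - 1)^2 * (x - n)\<close>; substituting this
    removes \<open>p\<close>, so \<open>weight\<close> depends on \<open>n\<close> and
    \<open>x\<close> alone.\<close>
  also have "s\<^sup>2 * ((a + b)\<^sup>2 - 2 * s) + (l * a\<^sup>2 + r * b\<^sup>2)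
      = s * weight n x + cub n p x * ((n - 2) * x - 4 * s)"
    unfolding a_def b' cub_def n p s_def weight_def by (simp add: algebra_simps power_numeral_reduce)
  finally have num: "a\<^sup>2 * (s\<^sup>2 + b ^ 4 + l + r * y ^ 4) = s * weight n x"
    using x by simp
  have "(s\<^sup>2 + b ^ 4 + l + r * y ^ 4) / (s + b\<^sup>2 + l + r * y\<^sup>2)\<^sup>2
      = a\<^sup>2 * (s\<^sup>2 + b ^ 4 + l + r * y ^ 4) / (a * (s + b\<^sup>2 + l + r * y\<^sup>2))\<^sup>2"
    using \<open>a \<noteq> 0\<close> by (simp add: power_mult_distrib)
  also have "\<dots> = s * weight n x
      / ((x - 1) * (x * (3 * x\<^sup>2 - 2 * (n + 2) * x + 2 * n + 1 + p)))\<^sup>2"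
    unfolding den num ..
  also have "\<dots> = weight n x / (x * (3 * x\<^sup>2 - 2 * (n + 2) * x + 2 * n + 1 + p))\<^sup>2"
    using s(1) by (simp add: power_mult_distrib[of "x - 1"] flip: s_def)
  finally show ?thesis using s by simp
qed

section \<open>The Laplacian of a double star\<close>

lemma neighbours_double_star:
  "{j. (0, j) \<in> parcs (double_star l r)} = insert 1 {2..<l + 2}"
  "{j. (1, j) \<in> parcs (double_star l r)} = insert 0 {l + 2..<l + r + 2}"
  "i \<in> {2..<l + 2} \<Longrightarrow> {j. (i, j) \<in> parcs (double_star l r)} = {0}"
  "i \<in> {l + 2..<l + r + 2} \<Longrightarrow> {j. (i, j) \<in> parcs (double_star l r)} = {1}"
  by (auto simp: double_star_def)

lemma split_vertices: "{..<l + r + 2} = {0, 1} \<union> {2..<l + 2} \<union> {l + 2..<l + r + 2 :: nat}"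
  by auto

lemma sum_vertices:
  fixes f :: "nat \<Rightarrow> real"
  shows "(\<Sum>i<l + r + 2. f i) = f 0 + f 1 + sum f {2..<l + 2} + sum f {l + 2..<l + r + 2}"
  unfolding split_vertices by (subst sum.union_disjoint | force)+

lemma mem_eigenspace_double_star:
  fixes v :: "real vec"
  assumes v: "v \<in> carrier_vec (l + r + 2)"
  shows "v \<in> eigenspace (laplacian_matrix (double_star l r)) \<theta> \<longleftrightarrow>
    (real l + 1 - \<theta>) * v $ 0 = v $ 1 + (\<Sum>i\<in>{2..<l + 2}. v $ i) \<and>
    (real r + 1 - \<theta>) * v $ 1 = v $ 0 + (\<Sum>i\<in>{l + 2..<l + r + 2}. v $ i) \<and>
    (\<forall>i\<in>{2..<l + 2}. (1 - \<theta>) * v $ i = v $ 0) \<and>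
    (\<forall>i\<in>{l + 2..<l + r + 2}. (1 - \<theta>) * v $ i = v $ 1)"
proof -
  let ?G = "double_star l r"
  have G: "pverts ?G = {0..<l + r + 2}" by (simp add: double_star_def)
  have L: "laplacian_matrix ?G \<in> carrier_mat (l + r + 2) (l + r + 2)"
    by (rule laplacian_matrix_carrier[OF G])
  have entry: "(laplacian_matrix ?G *\<^sub>v v) $ i = (\<Sum>j | (i, j) \<in> parcs ?G. v $ i - v $ j)"
    if "i < l + r + 2" for i
    using laplacian_mult_vec[OF pair_graph_double_star G v that] .
  have "v \<in> eigenspace (laplacian_matrix ?G) \<theta> \<longleftrightarrow>
      (\<forall>i\<in>{..<l + r + 2}. (laplacian_matrix ?G *\<^sub>v v) $ i = \<theta> * v $ i)"
    using v L by (auto simp: eigenspace_def vec_eq_iff)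
  also have "\<dots> \<longleftrightarrow>
      (\<forall>i\<in>{..<l + r + 2}. (\<Sum>j | (i, j) \<in> parcs ?G. v $ i - v $ j) = \<theta> * v $ i)"
    using entry by simp
  also have "\<dots> \<longleftrightarrow>
      (\<Sum>j\<in>insert 1 {2..<l + 2}. v $ 0 - v $ j) = \<theta> * v $ 0 \<and>
      (\<Sum>j\<in>insert 0 {l + 2..<l + r + 2}. v $ 1 - v $ j) = \<theta> * v $ 1 \<and>
      (\<forall>i\<in>{2..<l + 2}. v $ i - v $ 0 = \<theta> * v $ i) \<and>
      (\<forall>i\<in>{l + 2..<l + r + 2}. v $ i - v $ 1 = \<theta> * v $ i)"
    unfolding split_vertices ball_Un
    by (simp add: neighbours_double_star neighbours_double_star(2)[unfolded One_nat_def] del: One_nat_def)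
  finally show ?thesis
    by (auto simp: sum_subtractf algebra_simps)
qed

text \<open>For \<open>\<theta> \<noteq> 1\<close> an eigenvector is determined by its value at the centre \<open>a\<close>; the scaling is the one
  with value 1 at the leaves of \<open>a\<close>.\<close>

definition eigvec :: "nat \<Rightarrow> nat \<Rightarrow> real \<Rightarrow> real vec" where
  "eigvec l r \<theta> = vec (l + r + 2) (\<lambda>i.
     if i = 0 then 1 - \<theta>
     else if i = 1 then (1 - \<theta>)\<^sup>2 - real l * \<theta>
     else if i < l + 2 then 1
     else ((1 - \<theta>)\<^sup>2 - real l * \<theta>) / (1 - \<theta>))"

lemma eigvec_carrier: "eigvec l r \<theta> \<in> carrier_vec (l + r + 2)"
  by (simp add: eigvec_def)

lemma eigvec_index:
  "eigvec l r \<theta> $ 0 = 1 - \<theta>"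
  "eigvec l r \<theta> $ 1 = (1 - \<theta>)\<^sup>2 - real l * \<theta>"
  "i \<in> {2..<l + 2} \<Longrightarrow> eigvec l r \<theta> $ i = 1"
  "i \<in> {l + 2..<l + r + 2} \<Longrightarrow> eigvec l r \<theta> $ i = ((1 - \<theta>)\<^sup>2 - real l * \<theta>) / (1 - \<theta>)"
  by (auto simp: eigvec_def)

lemma eigvec_nonzero:
  assumes "\<theta> \<noteq> 1"
  shows "eigvec l r \<theta> \<noteq> 0\<^sub>v (l + r + 2)"
proof
  assume "eigvec l r \<theta> = 0\<^sub>v (l + r + 2)"
  then have "eigvec l r \<theta> $ 0 = 0" by simp
  with assms show False by (simp add: eigvec_index)
qed

text \<open>The equations at the leaves and at \<open>a\<close> force a multiple of
  \<open>eigvec\<close>; the equation at \<open>b\<close> then decides whether it is an eigenvector.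
  The factor \<open>\<theta>\<close> accounts for the eigenvalue 0 with its constant
  vectors.\<close>

lemma eigenspace_double_star:
  assumes "\<theta> \<noteq> 1"
  shows "eigenspace (laplacian_matrix (double_star l r)) \<theta> =
    (if \<theta> * cub (real (l + r + 2)) (real (l * r)) \<theta> = 0 then range (\<lambda>c. c \<cdot>\<^sub>v eigvec l r \<theta>)
     else {0\<^sub>v (l + r + 2)})" (is "?E = ?R")
proof -
  let ?s = "(1 - \<theta>)\<^sup>2"
  let ?b = "?s - real l * \<theta>"
  let ?\<phi> = "cub (real (l + r + 2)) (real (l * r)) \<theta>"
  have \<phi>: "?b * (?s - real r * \<theta>) - ?s = \<theta> * ?\<phi>"
    by (simp add: cub_def power2_eq_square algebra_simps)
  have carrier: "v \<in> carrier_vec (l + r + 2)" if "v \<in> ?E" for v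
    using that laplacian_matrix_carrier[of "double_star l r" "l + r + 2"]
    by (auto simp: eigenspace_def double_star_def)
  \<comment> \<open>Keeping \<open>c\<close> in the equivalence lets it serve twice: it admits every
    \<open>c\<close> at an eigenvalue and forces \<open>c = 0\<close> elsewhere.\<close>
  have smult: "c \<cdot>\<^sub>v eigvec l r \<theta> \<in> ?E \<longleftrightarrow> c * (\<theta> * ?\<phi>) = 0" for c
  proof -
    have "c \<cdot>\<^sub>v eigvec l r \<theta> \<in> ?E \<longleftrightarrow>
        (real l + 1 - \<theta>) * (c * (1 - \<theta>)) = c * ?b + real l * c \<and>
        (real r + 1 - \<theta>) * (c * ?b) = c * (1 - \<theta>) + real r * (c * (?b / (1 - \<theta>)))"
      using assms eigvec_carrier[of l r \<theta>]
      by (subst mem_eigenspace_double_star)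
        (auto simp: eigvec_index eigvec_index(2)[unfolded One_nat_def])
    \<comment> \<open>The entry of \<open>eigvec\<close> at \<open>b\<close> was chosen to solve the
      equation at \<open>a\<close>, so this conjunct is an identity.\<close>
    also have "(real l + 1 - \<theta>) * (c * (1 - \<theta>)) = c * ?b + real l * c"
      by (simp add: power2_eq_square algebra_simps)
    also have "(real r + 1 - \<theta>) * (c * ?b) = c * (1 - \<theta>) + real r * (c * (?b / (1 - \<theta>)))
        \<longleftrightarrow> (1 - \<theta>) * ((real r + 1 - \<theta>) * (c * ?b)) = c * ?s + real r * (c * ?b)"
      using assms by (simp add: field_simps power2_eq_square)
    also have "\<dots> \<longleftrightarrow> c * (?b * (?s - real r * \<theta>) - ?s) = 0"
      by (simp add: power2_eq_square algebra_simps)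
    finally show ?thesis unfolding \<phi> by simp
  qed
  have multiple: "v = (v $ 0 / (1 - \<theta>)) \<cdot>\<^sub>v eigvec l r \<theta>" if v: "v \<in> ?E" for v
  proof (rule eq_vecI)
    note eqs = v[unfolded mem_eigenspace_double_star[OF carrier[OF v]]]
    have leaf: "v $ i = v $ 0 / (1 - \<theta>)" if "i \<in> {2..<l + 2}" for i
      using eqs that assms by (auto simp: field_simps)
    then have "(real l + 1 - \<theta>) * v $ 0 = v $ 1 + real l * (v $ 0 / (1 - \<theta>))"
      using eqs by simp
    then have v1: "v $ 1 = v $ 0 / (1 - \<theta>) * ?b"
      using assms by (simp add: field_simps power2_eq_square)
    have leaf': "v $ i = v $ 1 / (1 - \<theta>)" if "i \<in> {l + 2..<l + r + 2}" for i
      using eqs that assms by (auto simp: field_simps)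
    fix i assume "i < dim_vec ((v $ 0 / (1 - \<theta>)) \<cdot>\<^sub>v eigvec l r \<theta>)"
    then have "i \<in> {..<l + r + 2}" using eigvec_carrier[of l r \<theta>] by auto
    then consider "i = 0" | "i = 1" | "i \<in> {2..<l + 2}" | "i \<in> {l + 2..<l + r + 2}"
      unfolding split_vertices by auto
    then show "v $ i = ((v $ 0 / (1 - \<theta>)) \<cdot>\<^sub>v eigvec l r \<theta>) $ i"
      using assms eigvec_carrier[of l r \<theta>] v1 leaf leaf'
      by cases (auto simp: eigvec_index eigvec_index(2)[unfolded One_nat_def])
  qed (use carrier[OF v] eigvec_carrier[of l r \<theta>] in auto)
  show ?thesis
  proof (cases "\<theta> * ?\<phi> = 0")
    case True
    then have "c \<cdot>\<^sub>v eigvec l r \<theta> \<in> ?E" for c using smult by simp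
    then show ?thesis unfolding if_P[OF True] using multiple by blast
  next
    case False
    have "v = 0\<^sub>v (l + r + 2)" if v: "v \<in> ?E" for v
    proof -
      have v0: "v $ 0 / (1 - \<theta>) = 0"
        using smult[of "v $ 0 / (1 - \<theta>)"] v False by (simp flip: multiple[OF v])
      then have "v = 0 \<cdot>\<^sub>v eigvec l r \<theta>" using multiple[OF v] unfolding v0 by simp
      then show ?thesis using eigvec_carrier[of l r \<theta>] by auto
    qed
    moreover have "0\<^sub>v (l + r + 2) \<in> ?E"
      by (subst mem_eigenspace_double_star) auto
    ultimately show ?thesis unfolding if_not_P[OF False] by blast
  qed
qed

lemma spectrum_double_star:
  assumes "l \<ge> 1" "r \<ge> 2"
  shows "spectrum (laplacian_matrix (double_star l r)) =
    {0, 1} \<union> {\<theta>. cub (real (l + r + 2)) (real (l * r)) \<theta> = 0}" (is "spectrum ?L = ?R")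
proof -
  have L: "?L \<in> carrier_mat (l + r + 2) (l + r + 2)"
    by (rule laplacian_matrix_carrier) (simp add: double_star_def)
  have "1 \<in> spectrum ?L"
  proof -
    \<comment> \<open>The difference of two leaves at \<open>b\<close>, available because
      \<open>r \<ge> 2\<close>; at \<open>a\<close> there may be only one leaf.\<close>
    define v :: "real vec" where
      "v = vec (l + r + 2) (\<lambda>i. if i = l + 2 then 1 else if i = l + 3 then -1 else 0)"
    have "v $ (l + 2) \<noteq> 0\<^sub>v (l + r + 2) $ (l + 2)"
      using assms by (simp add: v_def)
    then have "v \<noteq> 0\<^sub>v (l + r + 2)" by metis
    moreover have "(\<Sum>i\<in>{l + 2..<l + r + 2}. v $ i) =
        (\<Sum>i\<in>{l + 2..<l + r + 2}. (if i = l + 2 then 1 else 0) - (if i = l + 3 then 1 else 0))"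
      by (intro sum.cong) (auto simp: v_def)
    then have "(\<Sum>i\<in>{l + 2..<l + r + 2}. v $ i) = 0"
      using assms by (simp add: sum_subtractf)
    then have "v \<in> eigenspace ?L 1"
      by (subst mem_eigenspace_double_star) (auto simp: v_def)
    ultimately show ?thesis
      using mem_spectrum_iff[OF L] by blast
  qed
  moreover have "\<theta> \<in> spectrum ?L \<longleftrightarrow> \<theta> \<in> ?R" if "\<theta> \<noteq> 1" for \<theta>
  proof -
    let ?\<phi> = "cub (real (l + r + 2)) (real (l * r)) \<theta>"
    have "\<theta> \<in> spectrum ?L \<longleftrightarrow> \<theta> * ?\<phi> = 0"
    proof (cases "\<theta> * ?\<phi> = 0")
      case True
      have "eigvec l r \<theta> \<in> range (\<lambda>c. c \<cdot>\<^sub>v eigvec l r \<theta>)"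
        by (rule range_eqI[of _ _ 1]) simp
      then show ?thesis
        unfolding mem_spectrum_iff[OF L] eigenspace_double_star[OF that] if_P[OF True]
        using eigvec_nonzero[OF that, of l r] True by blast
    next
      case False
      then show ?thesis
        unfolding mem_spectrum_iff[OF L] eigenspace_double_star[OF that] if_not_P[OF False]
        by simp
    qed
    then show ?thesis using that by simp
  qed
  ultimately have elem: "\<theta> \<in> spectrum ?L \<longleftrightarrow> \<theta> \<in> ?R" for \<theta>
    by (cases "\<theta> = 1") simp_all
  show ?thesis by (rule Set.set_eqI) (rule elem)
qed

section \<open>The eigenspace of the eigenvalue 1 and the projection onto it\<close>

definition leaf_class :: "nat \<Rightarrow> nat \<Rightarrow> nat \<Rightarrow> nat set" where
  "leaf_class l r i = (if i \<in> {2..<l + 2} then {2..<l + 2}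
     else if i \<in> {l + 2..<l + r + 2} then {l + 2..<l + r + 2} else {})"

text \<open>Block diagonal with the centering matrices \<open>I - J / l\<close> and
  \<open>I - J / r\<close>, where \<open>J\<close> is all ones; the centres have the empty class and
  hence zero rows.\<close>

definition leaf_projection :: "nat \<Rightarrow> nat \<Rightarrow> real mat" where
  "leaf_projection l r = mat (l + r + 2) (l + r + 2) (\<lambda>(i, j).
     if j \<in> leaf_class l r i then (if i = j then 1 else 0) - 1 / real (card (leaf_class l r i)) else 0)"

lemma leaf_projection_mult:
  assumes "v \<in> carrier_vec (l + r + 2)" "i < l + r + 2"
  shows "(leaf_projection l r *\<^sub>v v) $ i = (if leaf_class l r i = {} then 0
    else v $ i - (\<Sum>j\<in>leaf_class l r i. v $ j) / real (card (leaf_class l r i)))"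
proof -
  let ?C = "leaf_class l r i"
  have C: "?C \<subseteq> {0..<l + r + 2}" "finite ?C" by (auto simp: leaf_class_def)
  have "(leaf_projection l r *\<^sub>v v) $ i = (\<Sum>j\<in>{0..<l + r + 2}. if j \<in> ?C
      then ((if i = j then 1 else 0) - 1 / real (card ?C)) * v $ j else 0)"
    using assms by (auto simp: leaf_projection_def scalar_prod_def intro!: sum.cong)
  also have "\<dots> = (\<Sum>j\<in>{0..<l + r + 2} \<inter> ?C. ((if i = j then 1 else 0) - 1 / real (card ?C)) * v $ j)"
    by (rule sum.inter_restrict[symmetric]) simp
  also have "{0..<l + r + 2} \<inter> ?C = ?C"
    using C by blast
  also have "(\<Sum>j\<in>?C. ((if i = j then 1 else 0) - 1 / real (card ?C)) * v $ j)
      = (\<Sum>j\<in>?C. (if i = j then v $ j else 0) - v $ j / real (card ?C))"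
    by (intro sum.cong) (auto simp: algebra_simps)
  also have "\<dots> = (if i \<in> ?C then v $ i else 0) - (\<Sum>j\<in>?C. v $ j) / real (card ?C)"
    using C by (simp add: sum_subtractf sum_divide_distrib)
  also have "i \<in> ?C \<longleftrightarrow> ?C \<noteq> {}"
    by (auto simp: leaf_class_def)
  finally show ?thesis by auto
qed

text \<open>At eigenvalue 1 the leaf equations say that the adjacent centre has value 0, and the
  centre equations then say that the leaf sums vanish.\<close>

lemma mem_eigenspace_one_double_star:
  assumes "l \<ge> 1" "r \<ge> 1" and v: "v \<in> carrier_vec (l + r + 2)"
  shows "v \<in> eigenspace (laplacian_matrix (double_star l r)) 1 \<longleftrightarrow>
    v $ 0 = 0 \<and> v $ 1 = 0 \<and>
    (\<Sum>i\<in>{2..<l + 2}. v $ i) = 0 \<and> (\<Sum>i\<in>{l + 2..<l + r + 2}. v $ i) = 0"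
proof -
  have "2 \<in> {2..<l + 2}" "l + 2 \<in> {l + 2..<l + r + 2}" using assms by auto
  then show ?thesis
    unfolding mem_eigenspace_double_star[OF v] by fastforce
qed

text \<open>Subtracting class means lands in the eigenspace. The removed part is constant on each
  leaf class, hence orthogonal to vectors that vanish at the centres and have zero class
  sums.\<close>

lemma is_orthogonal_projection_leaf_projection:
  assumes l: "l \<ge> 1" and r: "r \<ge> 1"
  shows "is_orthogonal_projection (l + r + 2)
    (eigenspace (laplacian_matrix (double_star l r)) 1) (leaf_projection l r)"
proof -
  let ?n = "l + r + 2"
  let ?E = "eigenspace (laplacian_matrix (double_star l r)) 1"
  let ?A = "{2..<l + 2}" and ?B = "{l + 2..<l + r + 2}"
  have P: "leaf_projection l r \<in> carrier_mat ?n ?n" by (simp add: leaf_projection_def)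
  have E_carrier: "w \<in> carrier_vec ?n" if "w \<in> ?E" for w
    using that laplacian_matrix_carrier[of "double_star l r" ?n]
    by (auto simp: eigenspace_def double_star_def)
  have idx: "(leaf_projection l r *\<^sub>v v) $ 0 = 0" "(leaf_projection l r *\<^sub>v v) $ 1 = 0"
    "i \<in> ?A \<Longrightarrow> (leaf_projection l r *\<^sub>v v) $ i = v $ i - (\<Sum>j\<in>?A. v $ j) / real l"
    "i \<in> ?B \<Longrightarrow> (leaf_projection l r *\<^sub>v v) $ i = v $ i - (\<Sum>j\<in>?B. v $ j) / real r"
    if "v \<in> carrier_vec ?n" for v i
    using leaf_projection_mult[OF that, of 0] leaf_projection_mult[OF that, of 1]
      leaf_projection_mult[OF that, of i] by (auto simp: leaf_class_def)
  have "leaf_projection l r *\<^sub>v v \<in> ?E" if v: "v \<in> carrier_vec ?n" for v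
  proof (subst mem_eigenspace_one_double_star[OF l r], goal_cases)
    case 1
    show ?case using P v by auto
  next
    case 2
    show ?case using l r idx[OF v] by (simp add: sum_subtractf)
  qed
  moreover have "(v - leaf_projection l r *\<^sub>v v) \<bullet> w = 0" if v: "v \<in> carrier_vec ?n" and w: "w \<in> ?E" for v w
  proof -
    note wE = w[unfolded mem_eigenspace_one_double_star[OF l r E_carrier[OF w]]]
    have "(v - leaf_projection l r *\<^sub>v v) \<bullet> w
        = (\<Sum>i<?n. (v $ i - (leaf_projection l r *\<^sub>v v) $ i) * w $ i)"
      using P v E_carrier[OF w] by (auto simp: scalar_prod_def atLeast0LessThan intro!: sum.cong)
    also have "\<dots> = (\<Sum>i\<in>?A. (\<Sum>j\<in>?A. v $ j) / real l * w $ i)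
        + (\<Sum>i\<in>?B. (\<Sum>j\<in>?B. v $ j) / real r * w $ i)"
      unfolding sum_vertices using wE idx[OF v] by simp
    also have "\<dots> = (\<Sum>j\<in>?A. v $ j) / real l * (\<Sum>i\<in>?A. w $ i)
        + (\<Sum>j\<in>?B. v $ j) / real r * (\<Sum>i\<in>?B. w $ i)"
      by (simp only: sum_distrib_left)
    also have "\<dots> = 0"
      using wE by (simp only: mult_zero_right add_0_left)
    finally show ?thesis .
  qed
  ultimately show ?thesis using P by (simp add: is_orthogonal_projection_def)
qed

section \<open>Diagonals of the projections and the closed form of the laziness\<close>

lemma leaf_projection_diag:
  assumes "l \<ge> 1" "r \<ge> 1"
  shows "(\<Sum>i<l + r + 2. (leaf_projection l r $$ (i, i))\<^sup>2)
    = (real l - 1)\<^sup>2 / real l + (real r - 1)\<^sup>2 / real r"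
proof -
  have "(\<Sum>i<l + r + 2. (leaf_projection l r $$ (i, i))\<^sup>2)
      = real l * (1 - 1 / real l)\<^sup>2 + real r * (1 - 1 / real r)\<^sup>2"
    unfolding sum_vertices by (simp add: leaf_projection_def leaf_class_def)
  also have "\<dots> = (real l - 1)\<^sup>2 / real l + (real r - 1)\<^sup>2 / real r"
    using assms by (simp add: power2_eq_square field_simps)
  finally show ?thesis .
qed

lemma eigvec_diag:
  fixes l r :: nat and \<theta> :: real
  assumes "\<theta> \<noteq> 1"
  defines "b \<equiv> (1 - \<theta>)\<^sup>2 - real l * \<theta>"
  shows "(\<Sum>i<l + r + 2. (line_projection (l + r + 2) (eigvec l r \<theta>) $$ (i, i))\<^sup>2)
    = ((1 - \<theta>) ^ 4 + b ^ 4 + real l + real r * (b / (1 - \<theta>)) ^ 4)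
      / ((1 - \<theta>)\<^sup>2 + b\<^sup>2 + real l + real r * (b / (1 - \<theta>))\<^sup>2)\<^sup>2"
proof -
  let ?v = "eigvec l r \<theta>"
  have "?v \<bullet> ?v = (\<Sum>i<l + r + 2. (?v $ i)\<^sup>2)"
    using eigvec_carrier[of l r \<theta>]
    by (auto simp: scalar_prod_def power2_eq_square atLeast0LessThan intro!: sum.cong)
  also have "\<dots> = (1 - \<theta>)\<^sup>2 + b\<^sup>2 + real l + real r * (b / (1 - \<theta>))\<^sup>2"
    unfolding sum_vertices b_def by (simp add: eigvec_index eigvec_index(2)[unfolded One_nat_def])
  finally have norm: "?v \<bullet> ?v = (1 - \<theta>)\<^sup>2 + b\<^sup>2 + real l + real r * (b / (1 - \<theta>))\<^sup>2" .
  have "(\<Sum>i<l + r + 2. (line_projection (l + r + 2) ?v $$ (i, i))\<^sup>2)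
      = (\<Sum>i<l + r + 2. (?v $ i) ^ 4 / (?v \<bullet> ?v)\<^sup>2)"
    by (intro sum.cong) (auto simp: line_projection_def power_divide power4_eq_xxxx power2_eq_square)
  also have "\<dots> = (\<Sum>i<l + r + 2. (?v $ i) ^ 4) / (?v \<bullet> ?v)\<^sup>2"
    by (rule sum_divide_distrib[symmetric])
  also have "(\<Sum>i<l + r + 2. (?v $ i) ^ 4) = (1 - \<theta>) ^ 4 + b ^ 4 + real l + real r * (b / (1 - \<theta>)) ^ 4"
    unfolding sum_vertices b_def by (simp add: eigvec_index eigvec_index(2)[unfolded One_nat_def])
  finally show ?thesis unfolding norm .
qed

lemma laziness_double_star:
  assumes l: "l \<ge> 1" and r: "r \<ge> 2" and n: "n = real (l + r + 2)" and p: "p = real (l * r)"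
  shows "0 < p * disc_factor n p"
    and "laziness (double_star l r) = n - 6 + 1 / n + numer n p / (n * (p * disc_factor n p))"
proof -
  let ?G = "double_star l r"
  let ?L = "laplacian_matrix ?G"
  have np: "n = real l + real r + 2" "p = real l * real r" using n p by auto
  have one_le_r: "r \<ge> 1" using r by simp
  have pos: "real l > 0" "real r > 0" using l r by auto
  obtain x y z where order: "0 < x" "x < 1" "1 < y" "y < z"
    and e: "x + y + z = n + 2" "x * y + x * z + y * z = 2 * n + 1 + p" "x * y * z = n"
    using cub_factorization[OF pos np] by metis
  note factor = cub_eq_prod[OF e]
  have spec: "spectrum ?L = {0, 1, x, y, z}"
    unfolding spectrum_double_star[OF l r] n[symmetric] p[symmetric] factor by auto
  define P where "P \<theta> = (if \<theta> = 1 then leaf_projection l r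
      else line_projection (l + r + 2) (eigvec l r \<theta>))" for \<theta>
  have P_one: "P 1 = leaf_projection l r"
    and P_other: "\<theta> \<noteq> 1 \<Longrightarrow> P \<theta> = line_projection (l + r + 2) (eigvec l r \<theta>)" for \<theta>
    by (simp_all add: P_def)
  have projection: "is_orthogonal_projection (l + r + 2) (eigenspace ?L \<theta>) (P \<theta>)"
    if "\<theta> \<in> spectrum ?L" for \<theta>
  proof (cases "\<theta> = 1")
    case True
    then show ?thesis
      using is_orthogonal_projection_leaf_projection l r by (simp add: P_def)
  next
    case False
    then have "\<theta> * cub n p \<theta> = 0" using that unfolding spec factor by auto
    then have "eigenspace ?L \<theta> = range (\<lambda>c. c \<cdot>\<^sub>v eigvec l r \<theta>)"
      using eigenspace_double_star[OF False, of l r] n p by simp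
    then show ?thesis
      using False is_orthogonal_projection_line[OF eigvec_carrier eigvec_nonzero[OF False]]
      by (simp add: P_def)
  qed
  have root: "(\<Sum>i<l + r + 2. (P \<theta> $$ (i, i))\<^sup>2)
      = weight n \<theta> / (\<theta> * (3 * \<theta>\<^sup>2 - 2 * (n + 2) * \<theta> + 2 * n + 1 + p))\<^sup>2"
    if "\<theta> \<in> {x, y, z}" for \<theta>
  proof -
    have \<theta>: "\<theta> \<noteq> 1" "cub n p \<theta> = 0" using that order by (auto simp: factor)
    show ?thesis
      unfolding P_other[OF \<theta>(1)] eigvec_diag[OF \<theta>(1)]
      by (rule weight_eq[OF np \<theta>(2,1) refl refl])
  qed
  \<comment> \<open>The product rule for the factored cubic; at a root only one of the three
    products survives.\<close>
  have deriv: "3 * t\<^sup>2 - 2 * (n + 2) * t + 2 * n + 1 + p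
      = (t - x) * (t - y) + (t - x) * (t - z) + (t - y) * (t - z)" for t
  proof -
    have "3 * t\<^sup>2 - 2 * (n + 2) * t + 2 * n + 1 + p = 3 * t\<^sup>2 - 2 * (n + 2) * t + (2 * n + 1 + p)"
      by simp
    then show ?thesis
      unfolding e(1,2)[symmetric] by (simp add: power2_eq_square algebra_simps)
  qed
  have sums: "((x - y) * (x - z) * (y - z))\<^sup>2 = p * disc_factor n p"
    "weight n x / (x * ((x - y) * (x - z)))\<^sup>2 + weight n y / (y * ((y - x) * (y - z)))\<^sup>2
      + weight n z / (z * ((z - x) * (z - y)))\<^sup>2
      = (numer n p - n * (n - 2) * disc_factor n p) / (n * (p * disc_factor n p))"
    using sum_weight[OF _ _ _ _ _ _ _ e] order np pos by auto
  show disc: "0 < p * disc_factor n p"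
    using order by (simp flip: sums(1))
  have nonzero: "n \<noteq> 0" "p \<noteq> 0" "disc_factor n p \<noteq> 0"
    using disc np(1) by auto
  have "laziness ?G = (\<Sum>\<theta>\<in>{0, 1, x, y, z}. \<Sum>i<l + r + 2. (P \<theta> $$ (i, i))\<^sup>2)"
    unfolding spec[symmetric] using projection by (intro laziness_eq) (auto simp: double_star_def)
  also have "\<dots> = (\<Sum>i<l + r + 2. (P 0 $$ (i, i))\<^sup>2) + (\<Sum>i<l + r + 2. (P 1 $$ (i, i))\<^sup>2)
      + (\<Sum>i<l + r + 2. (P x $$ (i, i))\<^sup>2) + (\<Sum>i<l + r + 2. (P y $$ (i, i))\<^sup>2)
      + (\<Sum>i<l + r + 2. (P z $$ (i, i))\<^sup>2)"
    using order by simp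
  \<comment> \<open>At eigenvalue 0, \<open>eigvec\<close> is the all-ones vector.\<close>
  also have "(\<Sum>i<l + r + 2. (P 0 $$ (i, i))\<^sup>2) = n / n\<^sup>2"
    unfolding P_other[OF zero_neq_one] eigvec_diag[OF zero_neq_one]
    by (simp add: np add_ac)
  also have "(\<Sum>i<l + r + 2. (P 1 $$ (i, i))\<^sup>2) = n - 6 + (n - 2) / p"
    unfolding P_one leaf_projection_diag[OF l one_le_r] np
    using pos by (simp add: power2_eq_square field_simps)
  also have "(\<Sum>i<l + r + 2. (P x $$ (i, i))\<^sup>2) = weight n x / (x * ((x - y) * (x - z)))\<^sup>2"
    using root[of x] unfolding deriv by simp
  also have "(\<Sum>i<l + r + 2. (P y $$ (i, i))\<^sup>2) = weight n y / (y * ((y - x) * (y - z)))\<^sup>2"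
    using root[of y] unfolding deriv by simp
  also have "(\<Sum>i<l + r + 2. (P z $$ (i, i))\<^sup>2) = weight n z / (z * ((z - x) * (z - y)))\<^sup>2"
    using root[of z] unfolding deriv by simp
  also have "n / n\<^sup>2 = 1 / n"
    by (simp add: power2_eq_square)
  finally have "laziness ?G = 1 / n + (n - 6 + (n - 2) / p)
      + (numer n p - n * (n - 2) * disc_factor n p) / (n * (p * disc_factor n p))"
    using sums(2) by simp
  also have "\<dots> = n - 6 + 1 / n + numer n p / (n * (p * disc_factor n p))"
    using nonzero by (simp add: diff_divide_distrib)
  finally show "laziness ?G = n - 6 + 1 / n + numer n p / (n * (p * disc_factor n p))" .
qed

section \<open>Comparison\<close>

text \<open>The left side changes sign when \<open>p\<close> and \<open>p'\<close> are exchanged, so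
  \<open>p' - p\<close> divides it and the quotient is a polynomial in \<open>s\<close> and
  \<open>m\<close>. Generic coefficients keep the expansion small.\<close>

lemma cubic_cross_diff:
  fixes a0 a1 a2 a3 b0 b1 b2 p p' :: "'a :: comm_ring_1"
  defines "s \<equiv> p + p'" and "m \<equiv> p * p'"
  shows "(a0 + a1 * p + a2 * p\<^sup>2 + a3 * p ^ 3) * (p' * (b0 + b1 * p' + b2 * p'\<^sup>2))
      - (a0 + a1 * p' + a2 * p'\<^sup>2 + a3 * p' ^ 3) * (p * (b0 + b1 * p + b2 * p\<^sup>2))
    = (p' - p) * (a0 * b0 + a0 * b1 * s + a0 * b2 * s\<^sup>2 + (a1 * b1 - a0 * b2 - a2 * b0) * m
      + (a1 * b2 - a3 * b0) * (m * s) + (a2 * b2 - a3 * b1) * m\<^sup>2)"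
  unfolding s_def m_def by (simp add: algebra_simps power2_eq_square power3_eq_cube)

lemma numer_cross_diff:
  fixes p p' :: real
  defines "s \<equiv> p + p'" and "m \<equiv> p * p'"
  shows "numer n p * (p' * disc_factor n p') - numer n p' * (p * disc_factor n p)
    = 2 * n * (p' - p) * (3 * (n - 2) * (n - 1) ^ 3 * (4 * (n - 1) ^ 3 + (n\<^sup>2 - 20 * n - 8) * s - 4 * s\<^sup>2)
      + m * (- 6 * n ^ 4 + 244 * n ^ 3 - 120 * n\<^sup>2 - 684 * n + 80
        + (72 * n\<^sup>2 - 128 * n - 16) * s - 88 * m))"
proof -
  define a0 where "a0 = 6 * n * (n - 2) * (n - 1) ^ 3"
  define a1 where "a1 = 8 * n ^ 4 - 72 * n ^ 3 + 124 * n\<^sup>2 - 36 * n + 12"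
  define a2 where "a2 = 2 * n ^ 3 - 43 * n\<^sup>2 + 88 * n + 24"
  define a3 where "a3 = 12 - 8 * n"
  define b0 where "b0 = 4 * (n - 1) ^ 3"
  define b1 where "b1 = n\<^sup>2 - 20 * n - 8"
  have "numer n t = a0 + a1 * t + a2 * t\<^sup>2 + a3 * t ^ 3" for t
    unfolding numer_def a0_def a1_def a2_def a3_def ..
  moreover have "disc_factor n t = b0 + b1 * t + (- 4) * t\<^sup>2" for t
    unfolding disc_factor_def b0_def b1_def by simp
  ultimately have "numer n p * (p' * disc_factor n p') - numer n p' * (p * disc_factor n p)
      = (p' - p) * (a0 * b0 + a0 * b1 * s + a0 * (- 4) * s\<^sup>2 + (a1 * b1 - a0 * (- 4) - a2 * b0) * m
        + (a1 * (- 4) - a3 * b0) * (m * s) + (a2 * (- 4) - a3 * b1) * m\<^sup>2)"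
    unfolding s_def m_def by (simp only: cubic_cross_diff)
  also have "a1 * b1 - a0 * (- 4) - a2 * b0
      = 2 * n * (- 6 * n ^ 4 + 244 * n ^ 3 - 120 * n\<^sup>2 - 684 * n + 80)"
    unfolding a0_def a1_def a2_def b0_def b1_def by (simp add: algebra_simps power_numeral_reduce)
  also have "a1 * (- 4) - a3 * b0 = 2 * n * (72 * n\<^sup>2 - 128 * n - 16)"
    unfolding a1_def a3_def b0_def by (simp add: algebra_simps power_numeral_reduce)
  also have "a2 * (- 4) - a3 * b1 = 2 * n * (- 88)"
    unfolding a2_def a3_def b1_def by (simp add: algebra_simps power_numeral_reduce)
  finally show ?thesis
    unfolding a0_def b0_def b1_def by (simp add: algebra_simps power2_eq_square)
qed

text \<open>Here \<open>r = l + 1 + k\<close>, so \<open>p\<close> and \<open>p'\<close> are the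
  leaf products before and after the move. Everything reduces to a polynomial in \<open>l\<close>
  and \<open>k\<close> with positive coefficients.\<close>

lemma numer_cross_less:
  fixes l k :: real
  assumes "l > 0" "k > 0" and n: "n = 2 * l + 3 + k" and p: "p = l * (l + 1 + k)" and p': "p' = p + k"
  shows "numer n p' * (p * disc_factor n p) < numer n p * (p' * disc_factor n p')"
proof -
  define s m where "s = p + p'" and "m = p * p'"
  have s: "s = 2 * l + 2 * l ^ 2 + (1 + 2 * l) * k"
    unfolding s_def p' p by (simp add: algebra_simps power2_eq_square)
  have m: "m = 1 * l ^ 2 + 2 * l ^ 3 + 1 * l ^ 4 + (1 * l + 3 * l ^ 2 + 2 * l ^ 3) * k + (1 * l + 1 *
       l ^ 2) * k ^ 2"
    unfolding m_def p' p by (simp add: algebra_simps power_numeral_reduce)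
  \<comment> \<open>The pieces are expanded separately. The second and third still have negative
    coefficients, which disappear only in the combined polynomial.\<close>
  have 1: "3 * (n - 2) * (n - 1) ^ 3 =
       24 + 120 * l + 216 * l ^ 2 + 168 * l ^ 3 + 48 * l ^ 4 + (60 + 216 * l + 252 * l ^ 2 +
       96 * l ^ 3) * k + (54 + 126 * l + 72 * l ^ 2) * k ^ 2 + (21 + 24 * l) * k ^ 3 + 3 * k ^
       4"
    unfolding n by (simp add: algebra_simps power_numeral_reduce)
  have 2: "4 * (n - 1) ^ 3 + (n\<^sup>2 - 20 * n - 8) * s - 4 * s\<^sup>2 =
       32 - 22 * l - 94 * l ^ 2 - 48 * l ^ 3 - 8 * l ^ 4 + (-11 - 94 * l - 72 * l ^ 2 - 16 * l
       ^ 3) * k + (6 - 14 * l - 6 * l ^ 2) * k ^ 2 + (5 + 2 * l) * k ^ 3"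
    unfolding n s by (simp add: algebra_simps power_numeral_reduce)
  have 3: "- 6 * n ^ 4 + 244 * n ^ 3 - 120 * n\<^sup>2 - 684 * n + 80 + (72 * n\<^sup>2 - 128 * n - 16) * s - 88 * m =
       3050 + 9568 * l + 8632 * l ^ 2 + 2992 * l ^ 3 + 392 * l ^ 4 + (4784 + 8632 * l + 4488 *
       l ^ 2 + 784 * l ^ 3) * k + (2056 + 1984 * l + 488 * l ^ 2) * k ^ 2 + (244 + 96 * l) * k
       ^ 3 - 6 * k ^ 4"
    unfolding n s m by (simp add: algebra_simps power_numeral_reduce)
  have "3 * (n - 2) * (n - 1) ^ 3 * (4 * (n - 1) ^ 3 + (n\<^sup>2 - 20 * n - 8) * s - 4 * s\<^sup>2)
      + m * (- 6 * n ^ 4 + 244 * n ^ 3 - 120 * n\<^sup>2 - 684 * n + 80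
        + (72 * n\<^sup>2 - 128 * n - 16) * s - 88 * m) =
       768 + 3312 * l + 5066 * l ^ 2 + 3860 * l ^ 3 + 2402 * l ^ 4 + 1648 * l ^ 5 + 704 * l ^
       6 + 128 * l ^ 7 + 8 * l ^ 8 + (1656 + 5066 * l + 5790 * l ^ 2 + 4804 * l ^ 3 + 4120 * l
       ^ 4 + 2112 * l ^ 5 + 448 * l ^ 6 + 32 * l ^ 7) * k + (1212 + 3046 * l + 4190 * l ^ 2 +
       4236 * l ^ 3 + 2416 * l ^ 4 + 584 * l ^ 5 + 48 * l ^ 6) * k ^ 2 + (558 + 1788 * l +
       2234 * l ^ 2 + 1312 * l ^ 3 + 340 * l ^ 4 + 32 * l ^ 5) * k ^ 3 + (489 + 1196 * l + 848
       * l ^ 2 + 248 * l ^ 3 + 26 * l ^ 4) * k ^ 4 + (363 + 544 * l + 256 * l ^ 2 + 36 * l ^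
       3) * k ^ 5 + (123 + 114 * l + 24 * l ^ 2) * k ^ 6 + (15 + 6 * l) * k ^ 7"
    unfolding 1 2 3 unfolding m by (simp add: algebra_simps power_numeral_reduce)
  also have "\<dots> > 0"
    using assms(1,2) by (intro add_pos_pos mult_pos_pos) auto
  finally have "0 < 2 * n * (p' - p) *
      (3 * (n - 2) * (n - 1) ^ 3 * (4 * (n - 1) ^ 3 + (n\<^sup>2 - 20 * n - 8) * s - 4 * s\<^sup>2)
      + m * (- 6 * n ^ 4 + 244 * n ^ 3 - 120 * n\<^sup>2 - 684 * n + 80
        + (72 * n\<^sup>2 - 128 * n - 16) * s - 88 * m))"
    using assms by (intro mult_pos_pos) auto
  then show ?thesis
    unfolding s_def m_def numer_cross_diff[symmetric] by simp
qed

theorem theorem5p3: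
  fixes l r n :: nat
  assumes "l \<ge> 1" and "r \<ge> 1"
    and "n = l + r + 2"
    and "real l \<le> real n / 2 - 2"
  shows "laziness (double_star l r) > laziness (double_star (l + 1) (r - 1))"
proof -
  \<comment> \<open>The bound on \<open>l\<close> amounts to this; it gives \<open>k \<ge> 1\<close>
    and \<open>r - 1 \<ge> 2\<close>, so the closed form applies to both stars.\<close>
  have lr: "l + 2 \<le> r" using assms(3,4) by linarith
  define k where "k = real r - real l - 1"
  define p p' where "p = real (l * r)" and "p' = real ((l + 1) * (r - 1))"
  define q q' where "q = p * disc_factor n p" and "q' = p' * disc_factor n p'"
  have n: "real n = real (l + r + 2)" "real n = real ((l + 1) + (r - 1) + 2)"
    using assms(3) lr by auto
  have q: "0 < q"
    and old: "laziness (double_star l r) = real n - 6 + 1 / n + numer n p / (n * q)"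
    unfolding q_def using laziness_double_star[OF assms(1) _ n(1) p_def] lr by auto
  have q': "0 < q'"
    and new: "laziness (double_star (l + 1) (r - 1)) = real n - 6 + 1 / n + numer n p' / (n * q')"
    unfolding q'_def using laziness_double_star[OF _ _ n(2) p'_def] lr assms(1) by auto
  have "real l > 0" "k > 0" "real n = 2 * real l + 3 + k" "p = real l * (real l + 1 + k)" "p' = p + k"
    using assms(1,3) lr by (auto simp: k_def p_def p'_def of_nat_diff algebra_simps)
  then have "numer n p' * q < numer n p * q'"
    unfolding q_def q'_def by (rule numer_cross_less)
  then have "numer n p' / q' < numer n p / q"
    using q q' by (simp add: pos_divide_less_eq pos_less_divide_eq)
  then have "numer n p' / q' / n < numer n p / q / n"
    using assms(3) by (intro divide_strict_right_mono) auto
  then show ?thesis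
    unfolding old new by (simp add: mult.commute)
qed

end
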